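(* Let $(M,d)$ be a metric space satisfying the Heine-Borel property (every closed and bounded subset of $M$ is compact). Then, for any $X,Y\in\mathrm{Ran}(M)$ and any weight $\omega$, there exists a combinatorial chain $(R_0,\dots,R_{k-1})$ between $X$ and $Y$ such that $$\ell^\omega(R_0,\dots,R_{k-1})=d^\omega(X,Y).$$ Furthermore, the chain $(R_0,\dots,R_{k-1})$ may be assumed to be a simple MBS-chain.
   Context: $\mathrm{Ran}(M)$ is the set of non-empty finite subsets of $M$ (called configurations). A weight is a non-decreasing function $\omega\colon\{1,2,3,\dots\}\to[1,\infty)$ with $\omega(1)=1$. For $X,Y\in\mathrm{Ran}(M)$, a surjective relation from $X$ to $Y$ is a subset $R\subset X\times Y$ such that every $x\in X$ is related to at least one $y\in Y$ and every $y\in Y$ is related to at least one $x\in X$; its $\omega$-length is $\ell^\omega(R)=\omega(\mathrm{card}(R))\sum_{(x,y)\in R}d(x,y)$, where $\mathrm{card}(R)$ is the number of pairs in $R$. A combinatorial chain from (or between) $X$ to (and) $Y$ consists of configurations $X=X_0,X_1,\dots,X_k=Y$ ($k\ge 0$) and surjective relations $R_j$ from $X_j$ to $X_{j+1}$, $0\le j\le k-1$; its $\omega$-length is $\ell^\omega(R_0,\dots,R_{k-1})=\sum_{j=0}^{k-1}\ell^\omega(R_j)$. The weighted distance $d^\omega(X,Y)$ is the infimum of the $\omega$-lengths of all combinatorial chains from $X$ to $Y$. A surjective relation $R$ from $X$ to $Y$ is a merge if it is the graph of a map $f\colon X\to Y$ for which there is $y_0\in Y$ with $\mathrm{card}(f^{-1}(y_0))\ge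 2$ and $f^{-1}(y)=\{y\}$ (as a subset of $X$) for all $y\ne y_0$; the merge is simple if $\mathrm{card}(f^{-1}(y_0))=2$. It is a bijection if it is the graph of a bijection $X\to Y$. It is a (simple) splitting if the opposite relation $R^{\mathrm{op}}\subset Y\times X$ is a (simple) merge from $Y$ to $X$. A combinatorial chain $(R_0,\dots,R_{k-1})$ is an MBS-chain if either there is $0\le l\le k-1$ such that $R_i$ is a merge for $i<l$, $R_l$ is a bijection and $R_i$ is a splitting for $i>l$; or there is $0\le l\le k$ such that $R_i$ is a merge for $i<l$ and a splitting for $i\ge l$. It is a simple MBS-chain if moreover all its merges and splittings are simple. *)

theory Defs
  imports "HOL-Analysis.Analysis"
begin

text \<open>The metric space \<open>M\<close> is a type \<open>'a\<close> of class \<^class>\<open>metric_space\<close>, with carrier \<^const>\<open>UNIV\<close>.\<close>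

definition Ran :: "'a set set" where
  "Ran = {X. finite X \<and> X \<noteq> {}}"

text \<open>The value of a weight at \<open>0\<close> is unconstrained and never used: surjective relations between
  configurations are non-empty and finite.\<close>

definition is_weight :: "(nat \<Rightarrow> real) \<Rightarrow> bool" where
  "is_weight \<omega> \<longleftrightarrow> mono_on {1..} \<omega> \<and> (\<forall>n\<ge>1. 1 \<le> \<omega> n) \<and> \<omega> 1 = 1"

definition surj_rel :: "'a set \<Rightarrow> 'a set \<Rightarrow> ('a \<times> 'a) set \<Rightarrow> bool" where
  "surj_rel X Y R \<longleftrightarrow>
     R \<subseteq> X \<times> Y \<and> (\<forall>x\<in>X. \<exists>y\<in>Y. (x, y) \<in> R) \<and> (\<forall>y\<in>Y. \<exists>x\<in>X. (x, y) \<in> R)"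

definition rel_length :: "(nat \<Rightarrow> real) \<Rightarrow> ('a::metric_space \<times> 'a) set \<Rightarrow> real" where
  "rel_length \<omega> R = \<omega> (card R) * (\<Sum>(x, y)\<in>R. dist x y)"

text \<open>A chain is given by its configurations \<open>Xs = [X\<^sub>0, \<dots>, X\<^sub>k]\<close> and its relations
  \<open>Rs = [R\<^sub>0, \<dots>, R\<^sub>k\<^sub>-\<^sub>1]\<close>, so that \<open>k = length Rs\<close>.\<close>

definition comb_chain :: "'a set \<Rightarrow> 'a set \<Rightarrow> 'a set list \<Rightarrow> ('a \<times> 'a) set list \<Rightarrow> bool" where
  "comb_chain X Y Xs Rs \<longleftrightarrow>
     length Xs = Suc (length Rs) \<and> set Xs \<subseteq> Ran \<and>
     Xs ! 0 = X \<and> Xs ! length Rs = Y \<and>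
     (\<forall>j<length Rs. surj_rel (Xs ! j) (Xs ! Suc j) (Rs ! j))"

definition chain_length :: "(nat \<Rightarrow> real) \<Rightarrow> ('a::metric_space \<times> 'a) set list \<Rightarrow> real" where
  "chain_length \<omega> Rs = (\<Sum>j<length Rs. rel_length \<omega> (Rs ! j))"

text \<open>For configurations \<open>X\<close> and \<open>Y\<close> and a weight \<open>\<omega>\<close> the infimum is over a set that is non-empty
  (as \<open>X \<times> Y\<close> is a surjective relation) and bounded below by \<open>0\<close>, hence is a genuine one.\<close>

definition weighted_dist :: "(nat \<Rightarrow> real) \<Rightarrow> 'a::metric_space set \<Rightarrow> 'a set \<Rightarrow> real" where
  "weighted_dist \<omega> X Y = Inf {chain_length \<omega> Rs |Xs Rs. comb_chain X Y Xs Rs}"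

definition graph_on :: "'a set \<Rightarrow> ('a \<Rightarrow> 'a) \<Rightarrow> ('a \<times> 'a) set" where
  "graph_on X f = {(x, f x) |x. x \<in> X}"

text \<open>\<open>R\<close> is a merge from \<open>X\<close> to \<open>Y\<close>, being the graph of \<open>f\<close> and with merging point \<open>y0\<close>.
  The point \<open>y0\<close> is unique, since the other fibres are singletons.\<close>

definition merge_via ::
    "'a set \<Rightarrow> 'a set \<Rightarrow> ('a \<times> 'a) set \<Rightarrow> ('a \<Rightarrow> 'a) \<Rightarrow> 'a \<Rightarrow> bool" where
  "merge_via X Y R f y0 \<longleftrightarrow>
     surj_rel X Y R \<and> f \<in> X \<rightarrow> Y \<and> R = graph_on X f \<and>
     y0 \<in> Y \<and> 2 \<le> card {x\<in>X. f x = y0} \<and>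
     (\<forall>y\<in>Y. y \<noteq> y0 \<longrightarrow> {x\<in>X. f x = y} = {y})"

definition is_merge :: "'a set \<Rightarrow> 'a set \<Rightarrow> ('a \<times> 'a) set \<Rightarrow> bool" where
  "is_merge X Y R \<longleftrightarrow> (\<exists>f y0. merge_via X Y R f y0)"

definition is_simple_merge :: "'a set \<Rightarrow> 'a set \<Rightarrow> ('a \<times> 'a) set \<Rightarrow> bool" where
  "is_simple_merge X Y R \<longleftrightarrow> (\<exists>f y0. merge_via X Y R f y0 \<and> card {x\<in>X. f x = y0} = 2)"

definition is_bijection :: "'a set \<Rightarrow> 'a set \<Rightarrow> ('a \<times> 'a) set \<Rightarrow> bool" where
  "is_bijection X Y R \<longleftrightarrow> (\<exists>f. bij_betw f X Y \<and> R = graph_on X f)"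

definition is_splitting :: "'a set \<Rightarrow> 'a set \<Rightarrow> ('a \<times> 'a) set \<Rightarrow> bool" where
  "is_splitting X Y R \<longleftrightarrow> is_merge Y X (R\<inverse>)"

definition is_simple_splitting :: "'a set \<Rightarrow> 'a set \<Rightarrow> ('a \<times> 'a) set \<Rightarrow> bool" where
  "is_simple_splitting X Y R \<longleftrightarrow> is_simple_merge Y X (R\<inverse>)"

definition MBS_chain :: "'a set \<Rightarrow> 'a set \<Rightarrow> 'a set list \<Rightarrow> ('a \<times> 'a) set list \<Rightarrow> bool" where
  "MBS_chain X Y Xs Rs \<longleftrightarrow>
     comb_chain X Y Xs Rs \<and>
     ((\<exists>l<length Rs.
         (\<forall>i<l. is_merge (Xs ! i) (Xs ! Suc i) (Rs ! i)) \<and>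
         is_bijection (Xs ! l) (Xs ! Suc l) (Rs ! l) \<and>
         (\<forall>i. l < i \<and> i < length Rs \<longrightarrow> is_splitting (Xs ! i) (Xs ! Suc i) (Rs ! i))) \<or>
      (\<exists>l\<le>length Rs.
         (\<forall>i<l. is_merge (Xs ! i) (Xs ! Suc i) (Rs ! i)) \<and>
         (\<forall>i. l \<le> i \<and> i < length Rs \<longrightarrow> is_splitting (Xs ! i) (Xs ! Suc i) (Rs ! i))))"

definition simple_MBS_chain ::
    "'a set \<Rightarrow> 'a set \<Rightarrow> 'a set list \<Rightarrow> ('a \<times> 'a) set list \<Rightarrow> bool" where
  "simple_MBS_chain X Y Xs Rs \<longleftrightarrow>
     MBS_chain X Y Xs Rs \<and>
     (\<forall>i<length Rs.
        (is_merge (Xs ! i) (Xs ! Suc i) (Rs ! i) \<longrightarrow>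
           is_simple_merge (Xs ! i) (Xs ! Suc i) (Rs ! i)) \<and>
        (is_splitting (Xs ! i) (Xs ! Suc i) (Rs ! i) \<longrightarrow>
           is_simple_splitting (Xs ! i) (Xs ! Suc i) (Rs ! i)))"

end

theory Submission
  imports Defs
begin

text \<open>
  The proof is a dynamic programming argument, by induction on \<open>card X + card Y\<close>.

  A chain that contains a merge somewhere can be rearranged, at no extra cost, so that two points
  of \<open>X\<close> are merged at once into some point \<open>w\<close>, both moving straight there. Indeed let \<open>w\<close> be a
  point with two predecessors in the first relation where this happens. If a predecessor is
  related to another point as well, its pair with \<open>w\<close> is superfluous and can be deleted.
  Otherwise the two predecessors can be moved to \<open>w\<close> one step earlier. This does not
  cost more: no point has two predecessors in the earlier relations, so they have as many pairs as
  target points, hence at most as many pairs as the relation after them, and the motion is paid at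
  a smaller or equal weight. Each such modification lowers the total number of pairs, so the
  process stops. By symmetry the same holds for splittings. A chain with no merges and no
  splittings is a chain of bijections, whose composition is not longer, by the triangle inequality.

  Consequently the length of every chain from \<open>X\<close> to \<open>Y\<close> is at least one of the following: the
  length of a bijection; the cost of collapsing a pair \<open>P\<close> of points of \<open>X\<close> to a point \<open>w\<close>, plus the
  distance from the collapsed configuration to \<open>Y\<close>; or the same with \<open>X\<close> and \<open>Y\<close> exchanged
  (\<open>chain_cost_bounds\<close>). For fixed \<open>P\<close> the second quantity is a Lipschitz function of \<open>w\<close> that
  is at least the distance from \<open>w\<close> to a point of \<open>P\<close>, so by the Heine-Borel property it has a
  minimum (\<open>collapse_bound_attains_inf\<close>). Thus finitely many candidates remain, each of which is at least
  the length of a simple MBS-chain by the induction hypothesis, and the least candidate bounds the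
  infimum from below. Compactness is used for one moving point only, so no limit
  of chains, with points colliding in the limit, has to be taken.
\<close>

section \<open>Weights and lengths of relations\<close>

lemma weight_mono: "is_weight \<omega> \<Longrightarrow> 1 \<le> m \<Longrightarrow> m \<le> n \<Longrightarrow> \<omega> m \<le> \<omega> n"
  by (auto simp: is_weight_def mono_on_def)

lemma weight_ge_1: "is_weight \<omega> \<Longrightarrow> 1 \<le> n \<Longrightarrow> 1 \<le> \<omega> n"
  by (auto simp: is_weight_def)

lemma surj_rel_finite: "surj_rel X Y R \<Longrightarrow> finite X \<Longrightarrow> finite Y \<Longrightarrow> finite R"
  using finite_subset[of R "X \<times> Y"] by (simp add: surj_rel_def)

lemma surj_rel_nonempty: "surj_rel X Y R \<Longrightarrow> X \<noteq> {} \<Longrightarrow> R \<noteq> {}"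
  by (auto simp: surj_rel_def)

lemma surj_rel_converse: "surj_rel X Y R \<Longrightarrow> surj_rel Y X (R\<inverse>)"
  by (auto simp: surj_rel_def)

lemma surj_rel_card_dom:
  assumes "surj_rel X Y R" "finite X" "finite Y"
  shows "card X \<le> card R"
proof -
  have "X \<subseteq> fst ` R"
  proof
    fix x assume "x \<in> X"
    then obtain y where "(x, y) \<in> R" using assms(1) by (auto simp: surj_rel_def)
    then show "x \<in> fst ` R" by (rule image_eqI[rotated]) simp
  qed
  then show ?thesis by (rule surj_card_le[OF surj_rel_finite[OF assms]])
qed

lemma card_pos_if_Ran: "X \<in> Ran \<Longrightarrow> 1 \<le> card X"
  by (simp add: Ran_def Suc_le_eq card_gt_0_iff)

lemma surj_rel_card_pos:
  assumes "surj_rel X Y R" "X \<in> Ran" "Y \<in> Ran"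
  shows "1 \<le> card R"
  using surj_rel_card_dom[OF assms(1)] card_pos_if_Ran[OF assms(2)] assms(2,3)
  by (auto simp: Ran_def)

lemma rel_length_converse: "rel_length \<omega> (R\<inverse>) = rel_length \<omega> R"
proof -
  have "(\<Sum>(x, y)\<in>R\<inverse>. dist x y) = (\<Sum>(x, y)\<in>R. dist x y)"
    by (rule sum.reindex_bij_witness[of _ prod.swap prod.swap])
       (auto simp: dist_commute)
  then show ?thesis by (simp add: rel_length_def)
qed

lemma sum_dist_nonneg: "0 \<le> (\<Sum>(x, y)\<in>R. dist x y)"
  by (simp add: sum_nonneg split_beta)

lemma rel_length_nonneg:
  assumes "is_weight \<omega>"
  shows "0 \<le> rel_length \<omega> R"
proof (cases "1 \<le> card R")
  case True
  then show ?thesis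
    using weight_ge_1[OF assms True] sum_dist_nonneg[of R] by (simp add: rel_length_def)
next
  case False
  then have "(\<Sum>(x, y)\<in>R. dist x y) = 0"
    by (cases "finite R") (auto simp: not_less_eq_eq card_eq_0_iff)
  then show ?thesis by (simp add: rel_length_def)
qed

lemma rel_length_le:
  assumes "is_weight \<omega>" "1 \<le> card R" "card R \<le> n" "(\<Sum>(x, y)\<in>R. dist x y) \<le> s"
  shows "rel_length \<omega> R \<le> \<omega> n * s"
proof -
  have "1 \<le> \<omega> (card R)" "\<omega> (card R) \<le> \<omega> n"
    using weight_ge_1 weight_mono assms by blast+
  then show ?thesis
    unfolding rel_length_def
    using assms(4) sum_dist_nonneg[of R] by (intro mult_mono) auto
qed

lemma sum_image_le_sum:
  fixes g :: "'b \<Rightarrow> real"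
  assumes "finite A" "\<And>b. 0 \<le> g b"
  shows "sum g (f ` A) \<le> (\<Sum>a\<in>A. g (f a))"
  using sum_image_le[of A g f] assms by (simp add: o_def)

lemma card_image_less:
  assumes "finite A" "\<not> inj_on f A"
  shows "card (f ` A) < card A"
  using card_image_le[OF assms(1), of f] eq_card_imp_inj_on[OF assms(1), of f] assms(2)
  by (auto simp: le_less)

lemma card_graph_on: "card (graph_on X f) = card X"
proof -
  have "graph_on X f = (\<lambda>x. (x, f x)) ` X" by (auto simp: graph_on_def)
  then show ?thesis by (simp add: card_image inj_on_def)
qed

lemma rel_length_graph_on: "rel_length \<omega> (graph_on X f) = \<omega> (card X) * (\<Sum>x\<in>X. dist x (f x))"
proof -
  have "graph_on X f = (\<lambda>x. (x, f x)) ` X" by (auto simp: graph_on_def)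
  then have "(\<Sum>(x, y)\<in>graph_on X f. dist x y) = (\<Sum>x\<in>X. dist x (f x))"
    by (simp add: sum.reindex inj_on_def)
  then show ?thesis by (simp add: rel_length_def card_graph_on)
qed

section \<open>Chains as an inductive predicate\<close>

text \<open>\<open>chain_cost \<omega> X Y c e\<close> says that some chain from \<open>X\<close> to \<open>Y\<close> has length \<open>c\<close> and \<open>e\<close> pairs in all of
  its relations together. The number \<open>e\<close> is the quantity that decreases when a chain is
  rearranged.\<close>

inductive chain_cost ::
    "(nat \<Rightarrow> real) \<Rightarrow> 'a::metric_space set \<Rightarrow> 'a set \<Rightarrow> real \<Rightarrow> nat \<Rightarrow> bool"
  for \<omega> where
  chain_nil: "X \<in> Ran \<Longrightarrow> chain_cost \<omega> X X 0 0"
| chain_step: "\<lbrakk>X \<in> Ran; surj_rel X Z R; chain_cost \<omega> Z Y c e\<rbrakk>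
    \<Longrightarrow> chain_cost \<omega> X Y (rel_length \<omega> R + c) (card R + e)"

lemma chain_cost_Ran: "chain_cost \<omega> X Y c e \<Longrightarrow> X \<in> Ran \<and> Y \<in> Ran"
  by (induction rule: chain_cost.induct) auto

lemma chain_cost_nonneg: "chain_cost \<omega> X Y c e \<Longrightarrow> is_weight \<omega> \<Longrightarrow> 0 \<le> c"
  by (induction rule: chain_cost.induct) (auto intro: add_nonneg_nonneg rel_length_nonneg)

lemma chain_cost_trans:
  "chain_cost \<omega> X Y c e \<Longrightarrow> chain_cost \<omega> Y Z c' e' \<Longrightarrow> chain_cost \<omega> X Z (c + c') (e + e')"
proof (induction rule: chain_cost.induct)
  case (chain_step X W R Y c e)
  then show ?case
    using chain_cost.chain_step[of X W R \<omega> Z "c + c'" "e + e'"] by (simp add: add.assoc)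
qed simp

lemma chain_cost_sym: "chain_cost \<omega> X Y c e \<Longrightarrow> chain_cost \<omega> Y X c e"
proof (induction rule: chain_cost.induct)
  case (chain_nil X)
  then show ?case by (rule chain_cost.chain_nil)
next
  case (chain_step X Z R Y c e)
  have "Z \<in> Ran" using chain_cost_Ran[OF chain_step.hyps(3)] by simp
  then have "chain_cost \<omega> Z X (rel_length \<omega> R + 0) (card R + 0)"
    using chain_cost.chain_step[OF _ surj_rel_converse[OF chain_step.hyps(2)]
        chain_cost.chain_nil[OF chain_step.hyps(1)], of \<omega>]
    by (simp add: rel_length_converse)
  from chain_cost_trans[OF chain_step.IH this] show ?case by (simp add: add.commute)
qed

lemma chain_length_Cons: "chain_length \<omega> (R # Rs) = rel_length \<omega> R + chain_length \<omega> Rs"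
  unfolding chain_length_def by (simp add: sum.lessThan_Suc_shift del: sum.lessThan_Suc)

lemma comb_chain_Cons:
  assumes "X \<in> Ran" "surj_rel X Z R" "comb_chain Z Y Xs Rs"
  shows "comb_chain X Y (X # Xs) (R # Rs)"
  using assms unfolding comb_chain_def
  by (auto simp: nth_Cons less_Suc_eq_0_disj split: nat.splits)

lemma chain_cost_imp_comb_chain:
  "chain_cost \<omega> X Y c e \<Longrightarrow> \<exists>Xs Rs. comb_chain X Y Xs Rs \<and> chain_length \<omega> Rs = c"
proof (induction rule: chain_cost.induct)
  case (chain_nil X)
  then have "comb_chain X X [X] []" "chain_length \<omega> [] = 0"
    by (auto simp: comb_chain_def chain_length_def)
  then show ?case by blast
next
  case (chain_step X Z R Y c e)
  then show ?case using comb_chain_Cons chain_length_Cons by metis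
qed

lemma comb_chain_imp_chain_cost:
  "comb_chain X Y Xs Rs \<Longrightarrow> \<exists>e. chain_cost \<omega> X Y (chain_length \<omega> Rs) e"
proof (induction Rs arbitrary: X Xs)
  case Nil
  then have "X = Y" "X \<in> Ran" by (cases Xs; auto simp: comb_chain_def)+
  then show ?case by (auto simp: chain_length_def intro: chain_nil)
next
  case (Cons R Rs)
  then obtain Xs' where Xs: "Xs = X # Xs'"
    by (cases Xs) (auto simp: comb_chain_def)
  have len: "length Xs' = Suc (length Rs)" using Cons.prems Xs by (simp add: comb_chain_def)
  have "comb_chain (Xs' ! 0) Y Xs' Rs"
    using Cons.prems Xs by (fastforce simp: comb_chain_def)
  then obtain e where "chain_cost \<omega> (Xs' ! 0) Y (chain_length \<omega> Rs) e"
    using Cons.IH by blast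
  moreover have "X \<in> Ran" "surj_rel X (Xs' ! 0) R"
    using Cons.prems Xs by (auto simp: comb_chain_def)
  ultimately show ?case using chain_step by (metis chain_length_Cons)
qed

lemma weighted_dist_eq_Inf: "weighted_dist \<omega> X Y = Inf {c. \<exists>e. chain_cost \<omega> X Y c e}"
proof -
  have "{chain_length \<omega> Rs |Xs Rs. comb_chain X Y Xs Rs} = {c. \<exists>e. chain_cost \<omega> X Y c e}"
    using comb_chain_imp_chain_cost chain_cost_imp_comb_chain by fast
  then show ?thesis by (simp add: weighted_dist_def)
qed

lemma chain_cost_exists:
  assumes "X \<in> Ran" "Y \<in> Ran"
  shows "\<exists>c e. chain_cost \<omega> X Y c e"
proof -
  have "surj_rel X Y (X \<times> Y)" using assms by (auto simp: surj_rel_def Ran_def)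
  then show ?thesis using assms chain_step chain_nil by metis
qed

lemma weighted_dist_le:
  assumes "is_weight \<omega>" "chain_cost \<omega> X Y c e"
  shows "weighted_dist \<omega> X Y \<le> c"
  unfolding weighted_dist_eq_Inf
  by (rule cInf_lower) (use assms chain_cost_nonneg in \<open>auto intro!: bdd_belowI[of _ 0]\<close>)

lemma weighted_dist_ge:
  assumes "X \<in> Ran" "Y \<in> Ran" "\<And>c e. chain_cost \<omega> X Y c e \<Longrightarrow> b \<le> c"
  shows "b \<le> weighted_dist \<omega> X Y"
  unfolding weighted_dist_eq_Inf
  by (rule cInf_greatest) (use assms chain_cost_exists in auto)

lemma weighted_dist_nonneg:
  "is_weight \<omega> \<Longrightarrow> X \<in> Ran \<Longrightarrow> Y \<in> Ran \<Longrightarrow> 0 \<le> weighted_dist \<omega> X Y"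
  by (rule weighted_dist_ge) (auto dest: chain_cost_nonneg)

lemma weighted_dist_step:
  assumes "is_weight \<omega>" "X \<in> Ran" "Z \<in> Ran" "Y \<in> Ran" "surj_rel X Z R"
  shows "weighted_dist \<omega> X Y \<le> rel_length \<omega> R + weighted_dist \<omega> Z Y"
proof -
  have "weighted_dist \<omega> X Y - rel_length \<omega> R \<le> weighted_dist \<omega> Z Y"
  proof (rule weighted_dist_ge[OF assms(3,4)])
    fix c e assume "chain_cost \<omega> Z Y c e"
    from weighted_dist_le[OF assms(1) chain_step[OF assms(2,5) this]]
    show "weighted_dist \<omega> X Y - rel_length \<omega> R \<le> c" by simp
  qed
  then show ?thesis by simp
qed

section \<open>Moving a merge to the front of a chain\<close>

definition collapse :: "'a set \<Rightarrow> 'a \<Rightarrow> 'a \<Rightarrow> 'a" where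
  "collapse P w x = (if x \<in> P then w else x)"

lemma collapse_Ran: "X \<in> Ran \<Longrightarrow> collapse P w ` X \<in> Ran"
  by (auto simp: Ran_def)

text \<open>When the points of \<open>P\<close> are related to \<open>w\<close> only, moving them to \<open>w\<close> beforehand
  leaves only the pair \<open>(w, w)\<close> of length \<open>0\<close> in place of their pairs, so that the relation becomes
  shorter by the whole distance from \<open>P\<close> to \<open>w\<close>.\<close>

lemma collapse_relation_source:
  fixes R :: "('a::metric_space \<times> 'a) set" and w :: 'a
  assumes "surj_rel X Y R" "finite R" "P \<subseteq> X" "\<And>p z. p \<in> P \<Longrightarrow> (p, z) \<in> R \<longleftrightarrow> z = w"
    and "p \<in> P" "q \<in> P" "p \<noteq> q"
  defines "R' \<equiv> (\<lambda>(u, v). (collapse P w u, v)) ` R"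
  shows "surj_rel (collapse P w ` X) Y R'"
    and "card R' < card R"
    and "(\<Sum>(x, y)\<in>R'. dist x y) + (\<Sum>p\<in>P. dist p w) \<le> (\<Sum>(x, y)\<in>R. dist x y)"
proof -
  show "surj_rel (collapse P w ` X) Y R'"
    using assms(1) unfolding surj_rel_def R'_def by (fastforce simp: image_iff)
  have "\<not> inj_on (\<lambda>(u, v). (collapse P w u, v)) R"
  proof
    assume inj: "inj_on (\<lambda>(u, v). (collapse P w u, v)) R"
    have "(p, w) \<in> R" "(q, w) \<in> R" using assms(4-6) by auto
    with inj_onD[OF inj, of "(p, w)" "(q, w)"] show False
      using assms(5-7) by (simp add: collapse_def)
  qed
  then show "card R' < card R"
    unfolding R'_def by (rule card_image_less[OF assms(2)])
  let ?g = "\<lambda>(u, v). dist (collapse P w u) v"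
  have sub: "P \<times> {w} \<subseteq> R" using assms(4) by auto
  have "(\<Sum>(x, y)\<in>R'. dist x y) \<le> sum ?g R"
    unfolding R'_def
    using sum_image_le_sum[OF assms(2), of "\<lambda>(x, y). dist x y" "\<lambda>(u, v). (collapse P w u, v)"]
    by (simp add: split_beta)
  also have "\<dots> = sum ?g (R - P \<times> {w}) + sum ?g (P \<times> {w})"
    using sum.subset_diff[OF sub assms(2)] .
  also have "sum ?g (P \<times> {w}) = 0"
    by (intro sum.neutral) (auto simp: collapse_def)
  also have "sum ?g (R - P \<times> {w}) = (\<Sum>(x, y)\<in>R - P \<times> {w}. dist x y)"
    using assms(4) by (intro sum.cong) (auto simp: collapse_def split: if_splits)
  finally have "(\<Sum>(x, y)\<in>R'. dist x y) \<le> (\<Sum>(x, y)\<in>R - P \<times> {w}. dist x y)" by simp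
  moreover have "(\<Sum>(x, y)\<in>P \<times> {w}. dist x y) = (\<Sum>p\<in>P. dist p w)"
    by (simp flip: sum.cartesian_product)
  ultimately show "(\<Sum>(x, y)\<in>R'. dist x y) + (\<Sum>p\<in>P. dist p w) \<le> (\<Sum>(x, y)\<in>R. dist x y)"
    using sum.subset_diff[OF sub assms(2), of "\<lambda>(x, y). dist x y"] by simp
qed

text \<open>When no point has two predecessors, each point of \<open>P\<close> is the target of one pair, so moving
  \<open>P\<close> to \<open>w\<close> in the target lengthens one pair per point, by at most the distance of that point
  from \<open>w\<close>. The equality \<open>card R = card Z\<close> is what allows the weights to be compared when a motion is moved
  across \<open>R\<close>.\<close>

lemma collapse_relation_target:
  fixes R :: "('a::metric_space \<times> 'a) set" and w :: 'a
  assumes "surj_rel X Z R" "finite R" "P \<subseteq> Z" "finite Z"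
    and inj: "inj_on snd R"
  defines "R' \<equiv> (\<lambda>(u, v). (u, collapse P w v)) ` R"
  shows "surj_rel X (collapse P w ` Z) R'"
    and "card R' \<le> card R"
    and "(\<Sum>(x, y)\<in>R'. dist x y) \<le> (\<Sum>(x, y)\<in>R. dist x y) + (\<Sum>p\<in>P. dist p w)"
    and "card R = card Z"
proof -
  show "surj_rel X (collapse P w ` Z) R'"
    using assms(1) unfolding surj_rel_def R'_def by (fastforce simp: image_iff)
  show "card R' \<le> card R" unfolding R'_def using assms(2) by (rule card_image_le)
  have snd_R: "snd ` R = Z"
  proof
    show "snd ` R \<subseteq> Z" using assms(1) by (auto simp: surj_rel_def)
    show "Z \<subseteq> snd ` R" by (metis assms(1) snd_conv image_eqI subsetI surj_rel_def)
  qed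
  show "card R = card Z" using card_image[OF inj] snd_R by simp
  have "(\<Sum>(x, y)\<in>R'. dist x y) \<le> (\<Sum>(x, y)\<in>R. dist x (collapse P w y))"
    unfolding R'_def
    using sum_image_le_sum[OF assms(2), of "\<lambda>(x, y). dist x y" "\<lambda>(u, v). (u, collapse P w v)"]
    by (simp add: split_beta)
  also have "\<dots> \<le> (\<Sum>r\<in>R. dist (fst r) (snd r) + dist (snd r) (collapse P w (snd r)))"
    by (intro sum_mono) (auto simp: dist_triangle)
  also have "\<dots> = (\<Sum>(x, y)\<in>R. dist x y) + (\<Sum>r\<in>R. dist (snd r) (collapse P w (snd r)))"
    by (simp add: sum.distrib split_beta)
  also have "(\<Sum>r\<in>R. dist (snd r) (collapse P w (snd r))) = (\<Sum>z\<in>Z. dist z (collapse P w z))"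
    using sum.reindex[OF inj, of "\<lambda>z. dist z (collapse P w z)"] snd_R by (simp add: o_def)
  also have "\<dots> = (\<Sum>p\<in>P. dist p w)"
    using assms(3,4) by (intro sum.mono_neutral_cong_right) (auto simp: collapse_def)
  finally show "(\<Sum>(x, y)\<in>R'. dist x y) \<le> (\<Sum>(x, y)\<in>R. dist x y) + (\<Sum>p\<in>P. dist p w)" .
qed

definition cheap_injection ::
    "(nat \<Rightarrow> real) \<Rightarrow> 'a::metric_space set \<Rightarrow> 'a set \<Rightarrow> real \<Rightarrow> bool" where
  "cheap_injection \<omega> X Y c \<longleftrightarrow>
     (\<exists>h. inj_on h X \<and> h ` X \<subseteq> Y \<and> \<omega> (card X) * (\<Sum>x\<in>X. dist x (h x)) \<le> c)"

text \<open>The strict inequality \<open>e' < e\<close> makes the rearrangement of chains terminate.\<close>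

definition cheap_collapse ::
    "(nat \<Rightarrow> real) \<Rightarrow> 'a::metric_space set \<Rightarrow> 'a set \<Rightarrow> real \<Rightarrow> nat \<Rightarrow> bool" where
  "cheap_collapse \<omega> X Y c e \<longleftrightarrow>
     (\<exists>P w c' e'. P \<subseteq> X \<and> card P = 2 \<and> chain_cost \<omega> (collapse P w ` X) Y c' e' \<and> e' < e \<and>
        \<omega> (card X) * (\<Sum>p\<in>P. dist p w) + c' \<le> c)"

text \<open>If one of the two predecessors of \<open>w\<close> has a second successor, its pair with \<open>w\<close> can be
  dropped from \<open>R\<close>. If not, collapsing both to \<open>w\<close> first pays their motion at weight
  \<open>\<omega> (card X) \<le> \<omega> (card R)\<close>.\<close>

lemma first_relation_merges:
  assumes wt: "is_weight \<omega>" and X: "X \<in> Ran" and R: "surj_rel X Z R"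
    and ch: "chain_cost \<omega> Z Y c e"
    and uv: "(u, w) \<in> R" "(v, w) \<in> R" "u \<noteq> v"
  shows "(\<exists>c' e'. chain_cost \<omega> X Y c' e' \<and> c' \<le> rel_length \<omega> R + c \<and> e' < card R + e)
    \<or> cheap_collapse \<omega> X Y (rel_length \<omega> R + c) (card R + e)"
proof -
  have Z: "Z \<in> Ran" using chain_cost_Ran[OF ch] by simp
  have fR: "finite R" using surj_rel_finite[OF R] X Z by (simp add: Ran_def)
  \<comment> \<open>Here \<open>a\<close> keeps the successor \<open>z\<close> and \<open>w\<close> keeps the predecessor \<open>b\<close>.\<close>
  have delete: ?thesis if "(a, w) \<in> R" "(b, w) \<in> R" "a \<noteq> b" "(a, z) \<in> R" "z \<noteq> w" for a b z
  proof -
    let ?R = "R - {(a, w)}"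
    have S: "surj_rel X Z ?R"
    proof -
      have "\<exists>y\<in>Z. (x, y) \<in> ?R" if "x \<in> X" for x
        using R \<open>x \<in> X\<close> \<open>(a, z) \<in> R\<close> \<open>z \<noteq> w\<close> unfolding surj_rel_def
        by (cases "x = a") blast+
      moreover have "\<exists>x\<in>X. (x, y) \<in> ?R" if "y \<in> Z" for y
        using R \<open>y \<in> Z\<close> \<open>(b, w) \<in> R\<close> \<open>a \<noteq> b\<close> unfolding surj_rel_def
        by (cases "y = w") blast+
      ultimately show ?thesis using R by (auto simp: surj_rel_def)
    qed
    have less: "card ?R < card R" using card_Diff1_less[OF fR that(1)] .
    have "(\<Sum>(x, y)\<in>?R. dist x y) \<le> (\<Sum>(x, y)\<in>R. dist x y)"
      using fR by (intro sum_mono2) auto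
    then have "rel_length \<omega> ?R \<le> rel_length \<omega> R"
      using rel_length_le[OF wt surj_rel_card_pos[OF S X Z], of "card R"] less
      by (simp add: rel_length_def)
    then have "rel_length \<omega> ?R + c \<le> rel_length \<omega> R + c" "card ?R + e < card R + e"
      using less by simp_all
    then show ?thesis using chain_step[OF X S ch] by blast
  qed
  show ?thesis
  proof (cases "\<exists>z. z \<noteq> w \<and> ((u, z) \<in> R \<or> (v, z) \<in> R)")
    case True
    then show ?thesis using delete[of u v] delete[of v u] uv by auto
  next
    case False
    let ?P = "{u, v}"
    have sub: "?P \<subseteq> X" using uv R by (auto simp: surj_rel_def)
    have only: "\<And>p z. p \<in> ?P \<Longrightarrow> (p, z) \<in> R \<longleftrightarrow> z = w" using False uv by auto
    define R' where "R' = (\<lambda>(a, b). (collapse ?P w a, b)) ` R"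
    note col = collapse_relation_source[OF R fR sub only, of u v, folded R'_def]
    have S: "surj_rel (collapse ?P w ` X) Z R'" and less: "card R' < card R"
      and sum: "(\<Sum>(x, y)\<in>R'. dist x y) + (\<Sum>p\<in>?P. dist p w) \<le> (\<Sum>(x, y)\<in>R. dist x y)"
      using col uv(3) by simp_all
    let ?s = "\<Sum>(x, y)\<in>R'. dist x y" and ?t = "\<Sum>p\<in>?P. dist p w"
    have "rel_length \<omega> R' \<le> \<omega> (card R) * ?s"
      using rel_length_le[OF wt surj_rel_card_pos[OF S collapse_Ran[OF X] Z]] less by simp
    moreover have "\<omega> (card X) * ?t \<le> \<omega> (card R) * ?t"
      using weight_mono[OF wt card_pos_if_Ran[OF X] surj_rel_card_dom[OF R]] X Z
      by (intro mult_right_mono sum_nonneg) (auto simp: Ran_def)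
    moreover have "\<omega> (card R) * (?s + ?t) \<le> rel_length \<omega> R"
      using sum weight_ge_1[OF wt surj_rel_card_pos[OF R X Z]]
      unfolding rel_length_def by (intro mult_left_mono) auto
    ultimately have "\<omega> (card X) * ?t + (rel_length \<omega> R' + c) \<le> rel_length \<omega> R + c"
      by (simp add: distrib_left)
    moreover have "chain_cost \<omega> (collapse ?P w ` X) Y (rel_length \<omega> R' + c) (card R' + e)"
      by (rule chain_step[OF collapse_Ran[OF X] S ch])
    moreover have "card ?P = 2" using uv(3) by simp
    moreover have "card R' + e < card R + e" using less by simp
    ultimately have "cheap_collapse \<omega> X Y (rel_length \<omega> R + c) (card R + e)"
      unfolding cheap_collapse_def using sub by (intro exI conjI)
    then show ?thesis ..
  qed
qed

text \<open>The motion of \<open>P\<close> to \<open>w\<close>, paid at weight \<open>\<omega> (card Z)\<close>, is incorporated into the preceding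
  relation \<open>R\<close>, where it is paid at weight at most \<open>\<omega> (card R) = \<omega> (card Z)\<close>.\<close>

lemma pull_collapse_through_step:
  assumes wt: "is_weight \<omega>" and X: "X \<in> Ran" and Z: "Z \<in> Ran" and R: "surj_rel X Z R"
    and inj: "inj_on snd R"
    and "cheap_collapse \<omega> Z Y c e"
  shows "\<exists>c' e'. chain_cost \<omega> X Y c' e' \<and> c' \<le> rel_length \<omega> R + c \<and> e' < card R + e"
proof -
  obtain P w c' e' where P: "P \<subseteq> Z" and ch: "chain_cost \<omega> (collapse P w ` Z) Y c' e'"
    and e': "e' < e" and c': "\<omega> (card Z) * (\<Sum>p\<in>P. dist p w) + c' \<le> c"
    using assms(6) by (auto simp: cheap_collapse_def)
  have fR: "finite R" and fZ: "finite Z" using surj_rel_finite[OF R] X Z by (auto simp: Ran_def)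
  define R' where "R' = (\<lambda>(u, v). (u, collapse P w v)) ` R"
  note col = collapse_relation_target(1-3)[OF R fR P fZ inj, where w = w, folded R'_def]
    and card_R = collapse_relation_target(4)[OF R fR P fZ inj]
  have "rel_length \<omega> R' \<le> \<omega> (card R) * ((\<Sum>(x, y)\<in>R. dist x y) + (\<Sum>p\<in>P. dist p w))"
    by (rule rel_length_le[OF wt surj_rel_card_pos[OF col(1) X collapse_Ran[OF Z]] col(2,3)])
  also have "\<dots> = rel_length \<omega> R + \<omega> (card Z) * (\<Sum>p\<in>P. dist p w)"
    using card_R by (simp add: rel_length_def distrib_left)
  finally have "rel_length \<omega> R' + c' \<le> rel_length \<omega> R + c" using c' by simp
  moreover have "card R' + e' < card R + e" using col(2) e' by simp
  ultimately show ?thesis using chain_step[OF X col(1) ch] by blast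
qed

text \<open>In a relation where no point has two predecessors, choosing a successor for each point gives
  an injection. Injectivity ensures that the moves from distinct points of \<open>X\<close> continue with
  distinct moves from \<open>Z\<close>, so the sums of distances do not grow; \<open>card X\<close> is at most \<open>card R\<close>
  and \<open>card Z\<close>, so neither do the weights.\<close>

lemma cheap_injection_step:
  assumes wt: "is_weight \<omega>" and X: "X \<in> Ran" and Z: "Z \<in> Ran" and R: "surj_rel X Z R"
    and inj: "inj_on snd R"
    and "cheap_injection \<omega> Z Y c"
  shows "cheap_injection \<omega> X Y (rel_length \<omega> R + c)"
proof -
  obtain h where h: "inj_on h Z" "h ` Z \<subseteq> Y" "\<omega> (card Z) * (\<Sum>z\<in>Z. dist z (h z)) \<le> c"
    using assms(6) by (auto simp: cheap_injection_def)
  have "\<forall>x\<in>X. \<exists>z. (x, z) \<in> R" using R by (auto simp: surj_rel_def)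
  then obtain f where f: "\<And>x. x \<in> X \<Longrightarrow> (x, f x) \<in> R" by metis
  have fZ: "f ` X \<subseteq> Z" using f R by (auto simp: surj_rel_def)
  have f_inj: "inj_on f X" using f inj by (metis inj_onD inj_onI prod.inject snd_conv)
  have fin: "finite X" "finite Z" "finite R"
    using X Z surj_rel_finite[OF R] by (auto simp: Ran_def)
  have pos: "1 \<le> card X" by (rule card_pos_if_Ran[OF X])
  have wR: "\<omega> (card X) \<le> \<omega> (card R)"
    by (rule weight_mono[OF wt pos surj_rel_card_dom[OF R fin(1,2)]])
  have wZ: "\<omega> (card X) \<le> \<omega> (card Z)"
    by (rule weight_mono[OF wt pos]) (metis f_inj fZ fin(2) card_inj_on_le)
  have w1: "1 \<le> \<omega> (card X)" by (rule weight_ge_1[OF wt pos])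
  have "(\<Sum>x\<in>X. dist x (f x)) = (\<Sum>(x, y)\<in>(\<lambda>x. (x, f x)) ` X. dist x y)"
    by (subst sum.reindex) (auto simp: inj_on_def)
  also have "\<dots> \<le> (\<Sum>(x, y)\<in>R. dist x y)"
    using f fin by (intro sum_mono2) auto
  finally have 1: "\<omega> (card X) * (\<Sum>x\<in>X. dist x (f x)) \<le> rel_length \<omega> R"
    unfolding rel_length_def using wR w1 by (intro mult_mono) (auto intro: sum_nonneg)
  have "(\<Sum>x\<in>X. dist (f x) (h (f x))) = (\<Sum>z\<in>f ` X. dist z (h z))"
    using f_inj by (simp add: sum.reindex)
  also have "\<dots> \<le> (\<Sum>z\<in>Z. dist z (h z))"
    using fZ fin by (intro sum_mono2) auto
  finally have "\<omega> (card X) * (\<Sum>x\<in>X. dist (f x) (h (f x))) \<le> \<omega> (card Z) * (\<Sum>z\<in>Z. dist z (h z))"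
    using wZ w1 by (intro mult_mono) (auto intro: sum_nonneg)
  then have 2: "\<omega> (card X) * (\<Sum>x\<in>X. dist (f x) (h (f x))) \<le> c" using h(3) by simp
  have "(\<Sum>x\<in>X. dist x (h (f x))) \<le> (\<Sum>x\<in>X. dist x (f x)) + (\<Sum>x\<in>X. dist (f x) (h (f x)))"
    unfolding sum.distrib[symmetric] by (intro sum_mono dist_triangle)
  then have "\<omega> (card X) * (\<Sum>x\<in>X. dist x (h (f x)))
      \<le> \<omega> (card X) * ((\<Sum>x\<in>X. dist x (f x)) + (\<Sum>x\<in>X. dist (f x) (h (f x))))"
    using w1 by (intro mult_left_mono) auto
  with 1 2 have "\<omega> (card X) * (\<Sum>x\<in>X. dist x (h (f x))) \<le> rel_length \<omega> R + c"
    by (simp add: distrib_left)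
  moreover have "inj_on (\<lambda>x. h (f x)) X"
    using comp_inj_on[OF f_inj inj_on_subset[OF h(1) fZ]] by (simp add: o_def)
  moreover have "(\<lambda>x. h (f x)) ` X \<subseteq> Y" using fZ h(2) by blast
  ultimately show ?thesis unfolding cheap_injection_def by blast
qed

lemma chain_trichotomy:
  assumes "chain_cost \<omega> X Y c e" "is_weight \<omega>"
  shows "cheap_injection \<omega> X Y c
    \<or> (\<exists>c' e'. chain_cost \<omega> X Y c' e' \<and> c' \<le> c \<and> e' < e)
    \<or> cheap_collapse \<omega> X Y c e"
  using assms
proof (induction rule: chain_cost.induct)
  case (chain_nil X)
  have "cheap_injection \<omega> X X 0"
    unfolding cheap_injection_def by (rule exI[of _ id]) auto
  then show ?case ..
next
  case (chain_step X Z R Y c e)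
  have Z: "Z \<in> Ran" using chain_cost_Ran[OF chain_step.hyps(3)] by simp
  note wt = \<open>is_weight \<omega>\<close> and X = chain_step.hyps(1) and R = chain_step.hyps(2)
  show ?case
  proof (cases "\<exists>u v w. (u, w) \<in> R \<and> (v, w) \<in> R \<and> u \<noteq> v")
    case True
    then show ?thesis
      using first_relation_merges[OF wt X R chain_step.hyps(3)] by blast
  next
    case False
    then have inj: "inj_on snd R" by (auto simp: inj_on_def)
    from chain_step.IH[OF wt] show ?thesis
    proof (elim disjE exE conjE)
      assume "cheap_injection \<omega> Z Y c"
      then show ?thesis using cheap_injection_step[OF wt X Z R inj] by blast
    next
      fix c' e' assume ch: "chain_cost \<omega> Z Y c' e'" and less: "c' \<le> c" "e' < e"
      have "rel_length \<omega> R + c' \<le> rel_length \<omega> R + c" "card R + e' < card R + e"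
        using less by auto
      then show ?thesis using chain_cost.chain_step[OF X R ch] by blast
    next
      assume "cheap_collapse \<omega> Z Y c e"
      then show ?thesis using pull_collapse_through_step[OF wt X Z R inj] by blast
    qed
  qed
qed

lemma cheap_injection_mono:
  "cheap_injection \<omega> X Y c' \<Longrightarrow> c' \<le> c \<Longrightarrow> cheap_injection \<omega> X Y c"
  unfolding cheap_injection_def by fastforce

lemma cheap_collapse_mono:
  assumes "cheap_collapse \<omega> X Y c' e'" "c' \<le> c" "e' \<le> e"
  shows "cheap_collapse \<omega> X Y c e"
proof -
  obtain P w a b where *: "P \<subseteq> X" "card P = 2" "chain_cost \<omega> (collapse P w ` X) Y a b"
    "b < e'" "\<omega> (card X) * (\<Sum>p\<in>P. dist p w) + a \<le> c'"
    using assms(1) unfolding cheap_collapse_def by blast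
  have "b < e" "\<omega> (card X) * (\<Sum>p\<in>P. dist p w) + a \<le> c" using * assms(2,3) by auto
  with *(1-3) show ?thesis unfolding cheap_collapse_def by blast
qed

text \<open>The middle alternative of \<open>chain_trichotomy\<close> can only occur finitely often, since the number of
  pairs decreases.\<close>

lemma chain_dichotomy:
  assumes "chain_cost \<omega> X Y c e" "is_weight \<omega>"
  shows "cheap_injection \<omega> X Y c \<or> cheap_collapse \<omega> X Y c e"
  using assms
proof (induction e arbitrary: c rule: less_induct)
  case (less e)
  from chain_trichotomy[OF less.prems] show ?case
  proof (elim disjE exE conjE)
    fix c' e' assume *: "chain_cost \<omega> X Y c' e'" "c' \<le> c" "e' < e"
    have "cheap_injection \<omega> X Y c' \<or> cheap_collapse \<omega> X Y c' e'"
      using less.IH[OF *(3,1) less.prems(2)] .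
    then show ?thesis
      using cheap_injection_mono[OF _ *(2)] cheap_collapse_mono[OF _ *(2) less_imp_le[OF *(3)]]
      by blast
  qed auto
qed

section \<open>Simple MBS-chains\<close>

definition simple_MBS_cost ::
    "(nat \<Rightarrow> real) \<Rightarrow> 'a::metric_space set \<Rightarrow> 'a set \<Rightarrow> real \<Rightarrow> bool" where
  "simple_MBS_cost \<omega> X Y c \<longleftrightarrow>
     (\<exists>Xs Rs. simple_MBS_chain X Y Xs Rs \<and> chain_length \<omega> Rs = c)"

lemma merge_card_less:
  assumes "finite X" "is_merge X Y R"
  shows "card Y < card X"
proof -
  obtain f y0 where m: "merge_via X Y R f y0" using assms(2) by (auto simp: is_merge_def)
  then have Y: "f ` X = Y"
    unfolding merge_via_def surj_rel_def graph_on_def by (auto; blast)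
  have "\<not> inj_on f X"
  proof
    assume inj: "inj_on f X"
    have "2 \<le> card {x\<in>X. f x = y0}" using m by (simp add: merge_via_def)
    moreover have "card {x\<in>X. f x = y0} \<le> 1"
      using inj card_le_Suc0_iff_eq[of "{x\<in>X. f x = y0}"] assms(1) by (auto simp: inj_on_def)
    ultimately show False by simp
  qed
  then show ?thesis
    using card_image_less[OF assms(1)] Y by blast
qed

lemma simple_MBS_cost_bijection:
  assumes "X \<in> Ran" "Y \<in> Ran" "is_bijection X Y R"
  shows "simple_MBS_cost \<omega> X Y (rel_length \<omega> R)"
proof -
  have S: "surj_rel X Y R"
    using assms(3) by (auto simp: is_bijection_def surj_rel_def graph_on_def bij_betw_def)
  have "card X = card Y"
    using assms(3) by (auto simp: is_bijection_def bij_betw_same_card)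
  then have no: "\<not> is_merge X Y R" "\<not> is_splitting X Y R"
    using merge_card_less[of X Y] merge_card_less[of Y X] assms(1,2)
    by (auto simp: is_splitting_def Ran_def)
  have "simple_MBS_chain X Y [X, Y] [R]"
    using assms S no
    by (auto simp: simple_MBS_chain_def MBS_chain_def comb_chain_def intro!: exI[of _ 0])
  moreover have "chain_length \<omega> [R] = rel_length \<omega> R" by (simp add: chain_length_def)
  ultimately show ?thesis by (auto simp: simple_MBS_cost_def)
qed

text \<open>Preceding a simple MBS-chain by a simple merge keeps its shape. Simplicity of the
  new first relation also requires that it is not a splitting, which holds since it
  lowers the cardinality.\<close>

lemma simple_MBS_cost_merge:
  assumes X: "X \<in> Ran" and R: "is_simple_merge X Z R" and "simple_MBS_cost \<omega> Z Y c"
  shows "simple_MBS_cost \<omega> X Y (rel_length \<omega> R + c)"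
proof -
  obtain Xs Rs where s: "simple_MBS_chain Z Y Xs Rs" and c: "chain_length \<omega> Rs = c"
    using assms(3) by (auto simp: simple_MBS_cost_def)
  let ?Xs = "X # Xs" and ?Rs = "R # Rs"
  have mb: "MBS_chain Z Y Xs Rs" using s by (simp add: simple_MBS_chain_def)
  have cc: "comb_chain Z Y Xs Rs" using mb by (simp add: MBS_chain_def)
  have Xs0: "Xs ! 0 = Z" "length Xs = Suc (length Rs)" "Z \<in> Ran"
    using cc by (auto simp: comb_chain_def)
  have merge: "is_merge X Z R" using R by (auto simp: is_simple_merge_def is_merge_def)
  have "surj_rel X Z R" using R by (auto simp: is_simple_merge_def merge_via_def)
  then have comb: "comb_chain X Y ?Xs ?Rs" using comb_chain_Cons[OF X _ cc] by simp
  have no_split: "\<not> is_splitting X Z R"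
    using merge_card_less[OF _ merge] merge_card_less[of Z X "R\<inverse>"] X Xs0(3)
    by (auto simp: is_splitting_def Ran_def)
  have "MBS_chain X Y ?Xs ?Rs"
    unfolding MBS_chain_def
  proof (intro conjI)
    show "comb_chain X Y ?Xs ?Rs" by (rule comb)
    from mb[unfolded MBS_chain_def] show "(\<exists>l<length ?Rs.
         (\<forall>i<l. is_merge (?Xs ! i) (?Xs ! Suc i) (?Rs ! i)) \<and>
         is_bijection (?Xs ! l) (?Xs ! Suc l) (?Rs ! l) \<and>
         (\<forall>i. l < i \<and> i < length ?Rs \<longrightarrow> is_splitting (?Xs ! i) (?Xs ! Suc i) (?Rs ! i))) \<or>
      (\<exists>l\<le>length ?Rs.
         (\<forall>i<l. is_merge (?Xs ! i) (?Xs ! Suc i) (?Rs ! i)) \<and>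
         (\<forall>i. l \<le> i \<and> i < length ?Rs \<longrightarrow> is_splitting (?Xs ! i) (?Xs ! Suc i) (?Rs ! i)))"
    proof (elim conjE disjE exE)
      fix l assume l: "l < length Rs" "\<forall>i<l. is_merge (Xs ! i) (Xs ! Suc i) (Rs ! i)"
        "is_bijection (Xs ! l) (Xs ! Suc l) (Rs ! l)"
        "\<forall>i. l < i \<and> i < length Rs \<longrightarrow> is_splitting (Xs ! i) (Xs ! Suc i) (Rs ! i)"
      show ?thesis
        by (rule disjI1, rule exI[of _ "Suc l"])
           (use l merge Xs0 in \<open>auto simp: less_Suc_eq_0_disj nth_Cons split: nat.splits\<close>)
    next
      fix l assume l: "l \<le> length Rs" "\<forall>i<l. is_merge (Xs ! i) (Xs ! Suc i) (Rs ! i)"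
        "\<forall>i. l \<le> i \<and> i < length Rs \<longrightarrow> is_splitting (Xs ! i) (Xs ! Suc i) (Rs ! i)"
      show ?thesis
        by (rule disjI2, rule exI[of _ "Suc l"])
           (use l merge Xs0 in \<open>auto simp: less_Suc_eq_0_disj nth_Cons split: nat.splits\<close>)
    qed
  qed
  then have "simple_MBS_chain X Y ?Xs ?Rs"
    using s R Xs0 no_split unfolding simple_MBS_chain_def
    by (auto simp: less_Suc_eq_0_disj)
  moreover have "chain_length \<omega> ?Rs = rel_length \<omega> R + c" using c by (simp add: chain_length_Cons)
  ultimately show ?thesis unfolding simple_MBS_cost_def by blast
qed

lemma bijection_converse:
  assumes "is_bijection X Y R"
  shows "is_bijection Y X (R\<inverse>)"
proof -
  obtain f where f: "bij_betw f X Y" "R = graph_on X f"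
    using assms by (auto simp: is_bijection_def)
  have "R\<inverse> = graph_on Y (inv_into X f)"
    using f unfolding graph_on_def bij_betw_def
    by (auto simp: image_iff inv_into_f_f)
  then show ?thesis using bij_betw_inv_into[OF f(1)] by (auto simp: is_bijection_def)
qed

text \<open>Reversal exchanges merges with splittings and thus reduces every statement on splittings to
  one on merges.\<close>

lemma simple_MBS_cost_sym:
  assumes "simple_MBS_cost \<omega> X Y c"
  shows "simple_MBS_cost \<omega> Y X c"
proof -
  obtain Xs Rs where s: "simple_MBS_chain X Y Xs Rs" and c: "chain_length \<omega> Rs = c"
    using assms by (auto simp: simple_MBS_cost_def)
  define n where "n = length Rs"
  define Xs' Rs' where "Xs' = rev Xs" and "Rs' = map converse (rev Rs)"
  have mb: "MBS_chain X Y Xs Rs" using s by (simp add: simple_MBS_chain_def)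
  have cc: "comb_chain X Y Xs Rs" using mb by (simp add: MBS_chain_def)
  have len: "length Xs = Suc n" "length Rs' = n" "length Xs' = Suc n"
    using cc by (auto simp: comb_chain_def n_def Xs'_def Rs'_def)
  have X0: "\<And>i. i \<le> n \<Longrightarrow> Xs' ! i = Xs ! (n - i)"
    using len by (simp add: Xs'_def rev_nth)
  have X1: "\<And>i. i < n \<Longrightarrow> Xs' ! i = Xs ! Suc (n - Suc i)"
    and X2: "\<And>i. i < n \<Longrightarrow> Xs' ! Suc i = Xs ! (n - Suc i)"
    using X0 by (simp_all add: Suc_diff_Suc)
  have R1: "\<And>i. i < n \<Longrightarrow> Rs' ! i = (Rs ! (n - Suc i))\<inverse>"
    by (simp add: Rs'_def rev_nth n_def)
  have spl: "is_merge (Xs' ! i) (Xs' ! Suc i) (Rs' ! i)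
      \<longleftrightarrow> is_splitting (Xs ! (n - Suc i)) (Xs ! Suc (n - Suc i)) (Rs ! (n - Suc i))"
    and mrg: "is_splitting (Xs' ! i) (Xs' ! Suc i) (Rs' ! i)
      \<longleftrightarrow> is_merge (Xs ! (n - Suc i)) (Xs ! Suc (n - Suc i)) (Rs ! (n - Suc i))"
    and sspl: "is_simple_merge (Xs' ! i) (Xs' ! Suc i) (Rs' ! i)
      \<longleftrightarrow> is_simple_splitting (Xs ! (n - Suc i)) (Xs ! Suc (n - Suc i)) (Rs ! (n - Suc i))"
    and smrg: "is_simple_splitting (Xs' ! i) (Xs' ! Suc i) (Rs' ! i)
      \<longleftrightarrow> is_simple_merge (Xs ! (n - Suc i)) (Xs ! Suc (n - Suc i)) (Rs ! (n - Suc i))"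
    if "i < n" for i
    using that X1 X2 R1 by (simp_all add: is_splitting_def is_simple_splitting_def)
  have comb: "comb_chain Y X Xs' Rs'"
    unfolding comb_chain_def len
  proof (intro conjI allI impI)
    show "Xs' ! 0 = Y" "Xs' ! n = X" using X0 cc by (auto simp: comb_chain_def n_def)
    show "set Xs' \<subseteq> Ran" using cc by (simp add: comb_chain_def Xs'_def)
    fix i assume i: "i < n"
    have "surj_rel (Xs ! (n - Suc i)) (Xs ! Suc (n - Suc i)) (Rs ! (n - Suc i))"
      using cc i by (simp add: comb_chain_def n_def)
    then show "surj_rel (Xs' ! i) (Xs' ! Suc i) (Rs' ! i)"
      using surj_rel_converse X1 X2 R1 i by metis
  qed simp
  have "MBS_chain Y X Xs' Rs'"
    unfolding MBS_chain_def len
  proof (intro conjI comb)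
    from mb[unfolded MBS_chain_def, folded n_def] show "(\<exists>l<n.
         (\<forall>i<l. is_merge (Xs' ! i) (Xs' ! Suc i) (Rs' ! i)) \<and>
         is_bijection (Xs' ! l) (Xs' ! Suc l) (Rs' ! l) \<and>
         (\<forall>i. l < i \<and> i < n \<longrightarrow> is_splitting (Xs' ! i) (Xs' ! Suc i) (Rs' ! i))) \<or>
      (\<exists>l\<le>n.
         (\<forall>i<l. is_merge (Xs' ! i) (Xs' ! Suc i) (Rs' ! i)) \<and>
         (\<forall>i. l \<le> i \<and> i < n \<longrightarrow> is_splitting (Xs' ! i) (Xs' ! Suc i) (Rs' ! i)))"
    proof (elim conjE disjE exE)
      fix l assume l: "l < n" "\<forall>i<l. is_merge (Xs ! i) (Xs ! Suc i) (Rs ! i)"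
        "is_bijection (Xs ! l) (Xs ! Suc l) (Rs ! l)"
        "\<forall>i. l < i \<and> i < n \<longrightarrow> is_splitting (Xs ! i) (Xs ! Suc i) (Rs ! i)"
      have "n - Suc l < n" "n - Suc (n - Suc l) = l" using l(1) by auto
      then have "is_bijection (Xs' ! (n - Suc l)) (Xs' ! Suc (n - Suc l)) (Rs' ! (n - Suc l))"
        using X1 X2 R1 bijection_converse[OF l(3)] by metis
      then show ?thesis
        by (intro disjI1 exI[of _ "n - Suc l"]) (use l spl mrg in auto)
    next
      fix l assume l: "l \<le> n" "\<forall>i<l. is_merge (Xs ! i) (Xs ! Suc i) (Rs ! i)"
        "\<forall>i. l \<le> i \<and> i < n \<longrightarrow> is_splitting (Xs ! i) (Xs ! Suc i) (Rs ! i)"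
      show ?thesis
        by (intro disjI2 exI[of _ "n - l"]) (use l spl mrg in auto)
    qed
  qed
  then have "simple_MBS_chain Y X Xs' Rs'"
    using s spl mrg sspl smrg unfolding simple_MBS_chain_def len
    by (auto simp: n_def)
  moreover have "chain_length \<omega> Rs' = chain_length \<omega> Rs"
  proof -
    have "chain_length \<omega> Rs' = (\<Sum>i<n. rel_length \<omega> (Rs ! (n - Suc i)))"
      unfolding chain_length_def len using R1 by (simp add: rel_length_converse)
    then show ?thesis
      unfolding chain_length_def n_def
      using sum.nat_diff_reindex[of "\<lambda>i. rel_length \<omega> (Rs ! i)" "length Rs"] by simp
  qed
  ultimately show ?thesis using c by (auto simp: simple_MBS_cost_def)
qed

lemma rel_length_collapse:
  assumes "P \<subseteq> X" "finite X"
  shows "rel_length \<omega> (graph_on X (collapse P w)) = \<omega> (card X) * (\<Sum>p\<in>P. dist p w)"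
proof -
  have "(\<Sum>x\<in>X. dist x (collapse P w x)) = (\<Sum>p\<in>P. dist p w)"
    using assms by (intro sum.mono_neutral_cong_right) (auto simp: collapse_def)
  then show ?thesis by (simp add: rel_length_graph_on)
qed

text \<open>If \<open>w\<close> is not occupied by a point of \<open>X\<close> outside of \<open>P\<close>, the fibre of \<open>collapse P w\<close> over \<open>w\<close>
  is the two-element set \<open>P\<close>, so the collapse is a simple merge.\<close>

lemma simple_MBS_cost_collapse_free:
  assumes X: "X \<in> Ran" and P: "P \<subseteq> X" "card P = 2" and w: "w \<notin> X - P"
    and "simple_MBS_cost \<omega> (collapse P w ` X) Y c"
  shows "simple_MBS_cost \<omega> X Y (\<omega> (card X) * (\<Sum>p\<in>P. dist p w) + c)"
proof -
  let ?R = "graph_on X (collapse P w)"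
  have fib: "{x\<in>X. collapse P w x = w} = P"
    using P w by (auto simp: collapse_def split: if_splits)
  obtain p where "p \<in> P" using P(2) by fastforce
  then have "w \<in> collapse P w ` X" using P(1) by (force simp: collapse_def)
  then have "merge_via X (collapse P w ` X) ?R (collapse P w) w"
    using fib P(2) unfolding merge_via_def
    by (auto simp: surj_rel_def graph_on_def collapse_def split: if_splits)
  then have "is_simple_merge X (collapse P w ` X) ?R"
    unfolding is_simple_merge_def using fib P(2) by (intro exI[of _ "collapse P w"] exI[of _ w]) simp
  from simple_MBS_cost_merge[OF X this assms(5)] show ?thesis
    using rel_length_collapse[OF P(1), of \<omega> w] X by (simp add: Ran_def)
qed

text \<open>If \<open>w\<close> is already occupied by a third point, collapsing \<open>P\<close> merges three points at once,
  which is not simple. It is then done by two simple merges with the point \<open>w\<close> at rest, the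
  second of which has no larger weight than the first.\<close>

lemma simple_MBS_cost_collapse:
  assumes wt: "is_weight \<omega>" and X: "X \<in> Ran" and P: "P \<subseteq> X" "card P = 2"
    and s: "simple_MBS_cost \<omega> (collapse P w ` X) Y c"
  shows "\<exists>c' \<le> \<omega> (card X) * (\<Sum>p\<in>P. dist p w) + c. simple_MBS_cost \<omega> X Y c'"
proof (cases "w \<in> X - P")
  case False
  then show ?thesis using simple_MBS_cost_collapse_free[OF X P False s] by blast
next
  case True
  obtain p q where pq: "P = {p, q}" "p \<noteq> q" using P(2) by (auto simp: card_2_iff)
  have ne: "p \<noteq> w" "q \<noteq> w" "p \<in> X" "q \<in> X" "w \<in> X" using True P(1) pq by auto
  \<comment> \<open>First \<open>p\<close> is merged with the resting point \<open>w\<close>, then \<open>q\<close>.\<close>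
  let ?X = "X - {p}"
  have im1: "collapse {p, w} w ` X = ?X" and im2: "collapse {q, w} w ` ?X = collapse P w ` X"
    using ne pq by (auto simp: collapse_def image_iff)
  have X': "?X \<in> Ran" using X ne by (auto simp: Ran_def)
  have "simple_MBS_cost \<omega> ?X Y (\<omega> (card ?X) * (\<Sum>p\<in>{q, w}. dist p w) + c)"
    by (rule simple_MBS_cost_collapse_free[OF X']) (use ne pq im2 s in auto)
  then have "simple_MBS_cost \<omega> X Y
      (\<omega> (card X) * (\<Sum>p\<in>{p, w}. dist p w) + (\<omega> (card ?X) * (\<Sum>p\<in>{q, w}. dist p w) + c))"
    by (intro simple_MBS_cost_collapse_free[OF X]) (use ne im1 in auto)
  moreover have "\<omega> (card ?X) * dist q w \<le> \<omega> (card X) * dist q w"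
    using weight_mono[OF wt card_pos_if_Ran[OF X']] X
    by (intro mult_right_mono) (auto simp: Ran_def card_Diff1_le)
  ultimately show ?thesis
    using ne pq by (intro exI[of _ "\<omega> (card X) * (\<Sum>p\<in>{p, w}. dist p w)
        + (\<omega> (card ?X) * (\<Sum>p\<in>{q, w}. dist p w) + c)"]) (auto simp: distrib_left)
qed

section \<open>Optimal merging points\<close>

definition collapse_bound ::
    "(nat \<Rightarrow> real) \<Rightarrow> 'a::metric_space set \<Rightarrow> 'a set \<Rightarrow> 'a set \<Rightarrow> 'a \<Rightarrow> real" where
  "collapse_bound \<omega> X Y P w =
     \<omega> (card X) * (\<Sum>p\<in>P. dist p w) + weighted_dist \<omega> (collapse P w ` X) Y"

text \<open>The collapsed configurations for \<open>v\<close> and for \<open>w\<close> are joined by a single relation in which only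
  the merged point moves. So the remaining distance is a Lipschitz function of the merging
  point.\<close>

lemma weighted_dist_collapse_le:
  assumes wt: "is_weight \<omega>" and X: "X \<in> Ran" and Y: "Y \<in> Ran" and P: "P \<subseteq> X"
  shows "weighted_dist \<omega> (collapse P v ` X) Y
    \<le> \<omega> (card X) * (real (card P) * dist v w) + weighted_dist \<omega> (collapse P w ` X) Y"
proof -
  have fin: "finite X" using X by (simp add: Ran_def)
  let ?R = "(\<lambda>x. (collapse P v x, collapse P w x)) ` X"
  have S: "surj_rel (collapse P v ` X) (collapse P w ` X) ?R"
    by (auto simp: surj_rel_def)
  have "(\<Sum>(x, y)\<in>?R. dist x y) \<le> (\<Sum>x\<in>X. dist (collapse P v x) (collapse P w x))"
    using sum_image_le_sum[OF fin, of "\<lambda>(x, y). dist x y"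
        "\<lambda>x. (collapse P v x, collapse P w x)"] by (simp add: split_beta)
  also have "\<dots> = (\<Sum>x\<in>P. dist v w)"
    using P fin by (intro sum.mono_neutral_cong_right) (auto simp: collapse_def)
  finally have "(\<Sum>(x, y)\<in>?R. dist x y) \<le> real (card P) * dist v w" by simp
  then have "rel_length \<omega> ?R \<le> \<omega> (card X) * (real (card P) * dist v w)"
    using rel_length_le[OF wt surj_rel_card_pos[OF S collapse_Ran[OF X] collapse_Ran[OF X]]
        card_image_le[OF fin]] by blast
  then show ?thesis
    using weighted_dist_step[OF wt collapse_Ran[OF X] collapse_Ran[OF X] Y S] by simp
qed

text \<open>The bound is continuous in \<open>w\<close> and is at least \<open>dist p w\<close>. Hence outside of the ball around \<open>p\<close>
  whose radius is the value at \<open>p\<close> it exceeds this value, and the ball is compact.\<close>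

lemma collapse_bound_attains_inf:
  fixes X Y :: "'a::metric_space set"
  assumes heine_borel: "\<forall>S :: 'a set. closed S \<longrightarrow> bounded S \<longrightarrow> compact S"
    and wt: "is_weight \<omega>" and X: "X \<in> Ran" and Y: "Y \<in> Ran" and P: "P \<subseteq> X" "p \<in> P"
  shows "\<exists>w0. \<forall>w. collapse_bound \<omega> X Y P w0 \<le> collapse_bound \<omega> X Y P w"
proof -
  let ?G = "collapse_bound \<omega> X Y P"
  have w1: "1 \<le> \<omega> (card X)" by (rule weight_ge_1[OF wt card_pos_if_Ran[OF X]])
  have finP: "finite P" using P X by (auto simp: Ran_def intro: finite_subset)
  have lower: "dist p w \<le> ?G w" for w
  proof -
    have "dist p w \<le> (\<Sum>p\<in>P. dist p w)"
      using member_le_sum[of p P "\<lambda>p. dist p w"] P(2) finP by simp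
    also have "\<dots> \<le> \<omega> (card X) * (\<Sum>p\<in>P. dist p w)"
      using w1 mult_right_mono[of 1 "\<omega> (card X)" "\<Sum>p\<in>P. dist p w"] by (simp add: sum_nonneg)
    also have "\<dots> \<le> ?G w"
      unfolding collapse_bound_def using weighted_dist_nonneg[OF wt collapse_Ran[OF X] Y] by simp
    finally show ?thesis .
  qed
  have "(\<omega> (card X) * real (card P))-lipschitz_on UNIV
      (\<lambda>w. weighted_dist \<omega> (collapse P w ` X) Y)"
  proof (rule lipschitz_onI)
    fix v w
    show "dist (weighted_dist \<omega> (collapse P v ` X) Y) (weighted_dist \<omega> (collapse P w ` X) Y)
        \<le> \<omega> (card X) * real (card P) * dist v w"
      using weighted_dist_collapse_le[OF wt X Y P(1), of v w]
        weighted_dist_collapse_le[OF wt X Y P(1), of w v]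
      by (simp add: dist_real_def abs_le_iff dist_commute mult.assoc)
  qed (use w1 in simp)
  then have "continuous_on UNIV (\<lambda>w. weighted_dist \<omega> (collapse P w ` X) Y)"
    by (rule lipschitz_on_continuous_on)
  moreover have "continuous_on UNIV (\<lambda>w. \<omega> (card X) * (\<Sum>p\<in>P. dist p w))"
    by (intro continuous_on_mult_left continuous_on_sum continuous_on_dist continuous_on_const
        continuous_on_id)
  ultimately have "continuous_on UNIV ?G"
    unfolding collapse_bound_def by (rule continuous_on_add[rotated])
  then have cont: "continuous_on (cball p (?G p)) ?G" by (rule continuous_on_subset) simp
  have "compact (cball p (?G p))" using heine_borel by simp
  moreover have "p \<in> cball p (?G p)" using lower[of p] by simp
  ultimately obtain w0 where w0: "\<And>w. w \<in> cball p (?G p) \<Longrightarrow> ?G w0 \<le> ?G w"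
    using continuous_attains_inf[OF _ _ cont] by blast
  have "?G w0 \<le> ?G w" for w
  proof (cases "dist p w \<le> ?G p")
    case False
    then show ?thesis using w0[OF \<open>p \<in> cball p (?G p)\<close>] lower[of w] by simp
  qed (simp add: w0)
  then show ?thesis by blast
qed

lemma collapse_card_less:
  assumes "finite X" "P \<subseteq> X" "card P = 2"
  shows "card (collapse P w ` X) < card X"
proof -
  obtain p q where pq: "P = {p, q}" "p \<noteq> q" using assms(3) by (auto simp: card_2_iff)
  then have "collapse P w p = collapse P w q" "p \<in> X" "q \<in> X"
    using assms(2) by (auto simp: collapse_def)
  then have "\<not> inj_on (collapse P w) X" using pq(2) inj_onD by metis
  then show ?thesis by (rule card_image_less[OF assms(1)])
qed

section \<open>Existence of optimal chains\<close>

lemma cheap_collapse_imp_bound: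
  assumes wt: "is_weight \<omega>" and "cheap_collapse \<omega> X Y c e"
  shows "\<exists>P w. P \<subseteq> X \<and> card P = 2 \<and> collapse_bound \<omega> X Y P w \<le> c"
proof -
  obtain P w a b where *: "P \<subseteq> X" "card P = 2" "chain_cost \<omega> (collapse P w ` X) Y a b"
    "\<omega> (card X) * (\<Sum>p\<in>P. dist p w) + a \<le> c"
    using assms(2) unfolding cheap_collapse_def by blast
  have "collapse_bound \<omega> X Y P w \<le> c"
    using weighted_dist_le[OF wt *(3)] *(4) by (simp add: collapse_bound_def)
  with *(1,2) show ?thesis by blast
qed

text \<open>If the dichotomy gives injections for both the chain and its reverse, then \<open>X\<close> and \<open>Y\<close> are
  equinumerous and either injection is a bijection.\<close>

lemma chain_cost_bounds:
  assumes wt: "is_weight \<omega>" and ch: "chain_cost \<omega> X Y c e"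
  shows "(\<exists>R. is_bijection X Y R \<and> rel_length \<omega> R \<le> c)
    \<or> (\<exists>P w. P \<subseteq> X \<and> card P = 2 \<and> collapse_bound \<omega> X Y P w \<le> c)
    \<or> (\<exists>P w. P \<subseteq> Y \<and> card P = 2 \<and> collapse_bound \<omega> Y X P w \<le> c)"
proof -
  have fin: "finite X" "finite Y" using chain_cost_Ran[OF ch] by (auto simp: Ran_def)
  {
    assume h: "cheap_injection \<omega> X Y c" and h': "cheap_injection \<omega> Y X c"
    obtain f where f: "inj_on f X" "f ` X \<subseteq> Y" "\<omega> (card X) * (\<Sum>x\<in>X. dist x (f x)) \<le> c"
      using h by (auto simp: cheap_injection_def)
    have "card Y \<le> card X" using h' fin card_inj_on_le by (auto simp: cheap_injection_def)
    then have "f ` X = Y" using f fin by (metis card_image card_seteq)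
    then have "is_bijection X Y (graph_on X f)"
      using f(1) by (auto simp: is_bijection_def bij_betw_def)
    then have ?thesis using f(3) by (metis rel_length_graph_on)
  }
  then show ?thesis
    using chain_dichotomy[OF ch wt] chain_dichotomy[OF chain_cost_sym[OF ch] wt]
      cheap_collapse_imp_bound[OF wt] by metis
qed

text \<open>Bijections between \<open>X\<close> and \<open>Y\<close>, and pairs of points in \<open>X\<close> or in \<open>Y\<close> with their best merging
  points, form a finite set of candidates. The least candidate is a lower bound for all
  chains, and it is reached by a simple MBS-chain: collapsing lowers the cardinality, so
  the induction hypothesis applies to the collapsed configuration.\<close>

lemma optimal_simple_MBS:
  fixes X Y :: "'a::metric_space set"
  assumes heine_borel: "\<forall>S :: 'a set. closed S \<longrightarrow> bounded S \<longrightarrow> compact S"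
    and wt: "is_weight \<omega>" and "X \<in> Ran" "Y \<in> Ran"
  shows "\<exists>c \<le> weighted_dist \<omega> X Y. simple_MBS_cost \<omega> X Y c"
  using assms(3,4)
proof (induction "card X + card Y" arbitrary: X Y rule: less_induct)
  case less
  note X = less.prems(1) and Y = less.prems(2)
  have fin: "finite X" "finite Y" using X Y by (auto simp: Ran_def)
  define pairs :: "'a set \<Rightarrow> 'a set set" where "pairs = (\<lambda>A. {P. P \<subseteq> A \<and> card P = 2})"
  define opt where "opt = (\<lambda>(A :: 'a set) B P. SOME w0. \<forall>w.
    collapse_bound \<omega> A B P w0 \<le> collapse_bound \<omega> A B P w)"
  have opt: "collapse_bound \<omega> A B P (opt A B P) \<le> collapse_bound \<omega> A B P w"
    if "A \<in> Ran" "B \<in> Ran" "P \<in> pairs A" for A B P w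
  proof -
    have "P \<subseteq> A" "P \<noteq> {}" using that(3) by (auto simp: pairs_def)
    then obtain p where "P \<subseteq> A" "p \<in> P" by blast
    from someI_ex[OF collapse_bound_attains_inf[OF heine_borel wt that(1,2) this]]
    show ?thesis unfolding opt_def by blast
  qed
  have IH: "\<exists>c \<le> collapse_bound \<omega> A B P w. simple_MBS_cost \<omega> A B c"
    if A: "A \<in> Ran" and B: "B \<in> Ran" and P_pair: "P \<in> pairs A"
      and card: "card A + card B = card X + card Y" for A B P w
  proof -
    have P: "P \<subseteq> A" "card P = 2" using P_pair by (auto simp: pairs_def)
    have "card (collapse P w ` A) < card A"
      using collapse_card_less[OF _ P] A by (simp add: Ran_def)
    then obtain c where c: "c \<le> weighted_dist \<omega> (collapse P w ` A) B"
      "simple_MBS_cost \<omega> (collapse P w ` A) B c"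
      using less.hyps[OF _ collapse_Ran[OF A] B, of P w] card by auto
    obtain c' where "c' \<le> \<omega> (card A) * (\<Sum>p\<in>P. dist p w) + c" "simple_MBS_cost \<omega> A B c'"
      using simple_MBS_cost_collapse[OF wt A P c(2)] by blast
    moreover from this(1) have "c' \<le> collapse_bound \<omega> A B P w"
      using c(1) by (simp add: collapse_bound_def)
    ultimately show ?thesis by blast
  qed
  define V where "V = rel_length \<omega> ` {R. is_bijection X Y R}
    \<union> (\<lambda>P. collapse_bound \<omega> X Y P (opt X Y P)) ` pairs X
    \<union> (\<lambda>P. collapse_bound \<omega> Y X P (opt Y X P)) ` pairs Y"
  have "{R. is_bijection X Y R} \<subseteq> Pow (X \<times> Y)"
    by (auto simp: is_bijection_def graph_on_def bij_betw_def)
  then have "finite V"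
    using fin unfolding V_def pairs_def by (simp add: finite_subset)
  have V_le: "\<exists>v\<in>V. v \<le> c" if ch: "chain_cost \<omega> X Y c e" for c e
    using chain_cost_bounds[OF wt ch]
  proof (elim disjE exE conjE)
    fix R assume "is_bijection X Y R" "rel_length \<omega> R \<le> c"
    then show ?thesis by (auto simp: V_def)
  next
    fix P w assume "P \<subseteq> X" "card P = 2" "collapse_bound \<omega> X Y P w \<le> c"
    then have "P \<in> pairs X" "collapse_bound \<omega> X Y P (opt X Y P) \<le> c"
      using opt[OF X Y, of P w] by (auto simp: pairs_def)
    then show ?thesis by (auto simp: V_def)
  next
    fix P w assume "P \<subseteq> Y" "card P = 2" "collapse_bound \<omega> Y X P w \<le> c"
    then have "P \<in> pairs Y" "collapse_bound \<omega> Y X P (opt Y X P) \<le> c"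
      using opt[OF Y X, of P w] by (auto simp: pairs_def)
    then show ?thesis by (auto simp: V_def)
  qed
  then have "V \<noteq> {}" using chain_cost_exists[OF X Y] by blast
  have Min_V: "Min V \<le> weighted_dist \<omega> X Y"
  proof (rule weighted_dist_ge[OF X Y])
    fix c e assume "chain_cost \<omega> X Y c e"
    then obtain v where "v \<in> V" "v \<le> c" using V_le by blast
    then show "Min V \<le> c" using Min_le[OF \<open>finite V\<close>, of v] by simp
  qed
  have attained: "\<exists>c\<le>v. simple_MBS_cost \<omega> X Y c" if "v \<in> V" for v
    using that unfolding V_def
  proof (elim UnE imageE)
    fix R assume "v = rel_length \<omega> R" "R \<in> {R. is_bijection X Y R}"
    then show ?thesis using simple_MBS_cost_bijection[OF X Y] by blast
  next
    fix P assume "v = collapse_bound \<omega> X Y P (opt X Y P)" "P \<in> pairs X"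
    then show ?thesis using IH[OF X Y, of P] by simp
  next
    fix P assume "v = collapse_bound \<omega> Y X P (opt Y X P)" "P \<in> pairs Y"
    then show ?thesis using IH[OF Y X, of P] simple_MBS_cost_sym by (metis add.commute)
  qed
  obtain c where "c \<le> Min V" "simple_MBS_cost \<omega> X Y c"
    using attained[OF Min_in[OF \<open>finite V\<close> \<open>V \<noteq> {}\<close>]] by blast
  then show ?case using Min_V order_trans by blast
qed

theorem theorem2p24:
  fixes X Y :: "'a::metric_space set" and \<omega> :: "nat \<Rightarrow> real"
  assumes heine_borel: "\<And>S :: 'a set. closed S \<Longrightarrow> bounded S \<Longrightarrow> compact S"
    and "X \<in> Ran" and "Y \<in> Ran" and "is_weight \<omega>"
  shows "\<exists>Xs Rs. comb_chain X Y Xs Rs \<and> chain_length \<omega> Rs = weighted_dist \<omega> X Y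
           \<and> simple_MBS_chain X Y Xs Rs"
proof -
  obtain c where "c \<le> weighted_dist \<omega> X Y" "simple_MBS_cost \<omega> X Y c"
    using optimal_simple_MBS[OF _ assms(4,2,3)] heine_borel by blast
  then obtain Xs Rs where s: "simple_MBS_chain X Y Xs Rs"
    and le: "chain_length \<omega> Rs \<le> weighted_dist \<omega> X Y"
    by (auto simp: simple_MBS_cost_def)
  have cc: "comb_chain X Y Xs Rs" using s by (simp add: simple_MBS_chain_def MBS_chain_def)
  then obtain e where "chain_cost \<omega> X Y (chain_length \<omega> Rs) e"
    using comb_chain_imp_chain_cost by blast
  from weighted_dist_le[OF assms(4) this] show ?thesis using s le cc by force
qed

end
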